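(* Let $w_1,w_2,\dots$ be numbers in $(0,1)$ with $w_0=\sum_{i=1}^\infty w_i$ finite and $w_0>1$. Let $\Omega$ be the set of sequences $\theta=(\theta_1,\theta_2,\dots)$ of positive numbers with $\sum_{i=1}^\infty w_i\theta_i<\infty$. Let $Y_1,Y_2,\dots$ be independent with $Y_i\sim\mathrm{Poisson}(\theta_i)$, where $\theta\in\Omega$ is unknown, and consider the loss function $$L(\theta,\delta)=\sum_{i=1}^\infty \frac{w_i(\delta_i-\theta_i)^2}{\theta_i}.$$ Then the estimator with components $$\widehat\theta_i=\Bigl\{1-\frac{w_0-1}{w_0-1+v(Y)}\Bigr\}Y_i,\qquad i=1,2,3,\dots,\qquad v(Y)=\sum_{i=1}^\infty w_iY_i,$$ has uniformly smaller risk than the estimator $\delta_0$ with components $\delta_{0,i}=Y_i$, that is, $\mathrm{E}_\theta L(\theta,\widehat\theta)<\mathrm{E}_\theta L(\theta,\delta_0)=w_0$ for all $\theta\in\Omega$.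
   Context: $\mathrm{E}_\theta$ denotes expectation when the independent counts have means $\theta_1,\theta_2,\dots$. For $\theta\in\Omega$, $v(Y)$ is finite with probability one. *)

theory Defs
  imports "HOL-Probability.Probability"
begin

text \<open>
  Sequences are indexed by \<^typ>\<open>nat\<close> starting from 0, so \<^term>\<open>w i\<close> and \<^term>\<open>\<theta> i\<close> stand for
  $w_{i+1}$ and $\theta_{i+1}$; the total $w_0$ of the weights is \<^term>\<open>suminf w\<close>.
\<close>

definition Omega :: "(nat \<Rightarrow> real) \<Rightarrow> (nat \<Rightarrow> real) set" where
  "Omega w = {\<theta>. (\<forall>i. 0 < \<theta> i) \<and> summable (\<lambda>i. w i * \<theta> i)}"

text \<open>The loss is a series of nonnegative terms with values in $[0,\infty]$.\<close>

definition loss :: "(nat \<Rightarrow> real) \<Rightarrow> (nat \<Rightarrow> real) \<Rightarrow> (nat \<Rightarrow> real) \<Rightarrow> ennreal" where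
  "loss w \<theta> d = (\<Sum>i. ennreal (w i * (d i - \<theta> i)\<^sup>2 / \<theta> i))"

text \<open>
  A real-valued sum: its value is unspecified on count sequences for which the series diverges.
  Under the Poisson model with \<^term>\<open>\<theta> \<in> Omega w\<close> these have probability zero.
\<close>

definition v :: "(nat \<Rightarrow> real) \<Rightarrow> (nat \<Rightarrow> nat) \<Rightarrow> real" where
  "v w y = (\<Sum>i. w i * real (y i))"

definition theta_hat :: "(nat \<Rightarrow> real) \<Rightarrow> (nat \<Rightarrow> nat) \<Rightarrow> nat \<Rightarrow> real" where
  "theta_hat w y i = (1 - (suminf w - 1) / (suminf w - 1 + v w y)) * real (y i)"

definition delta0 :: "(nat \<Rightarrow> nat) \<Rightarrow> nat \<Rightarrow> real" where
  "delta0 y i = real (y i)"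

definition poisson_model :: "'a measure \<Rightarrow> (nat \<Rightarrow> 'a \<Rightarrow> nat) \<Rightarrow> (nat \<Rightarrow> real) \<Rightarrow> bool" where
  "poisson_model M Y \<theta> \<longleftrightarrow>
     prob_space M \<and>
     prob_space.indep_vars M (\<lambda>_. count_space UNIV) Y UNIV \<and>
     (\<forall>i. distr M (count_space UNIV) (Y i) = measure_pmf (poisson_pmf (\<theta> i)))"

definition risk ::
  "'a measure \<Rightarrow> (nat \<Rightarrow> 'a \<Rightarrow> nat) \<Rightarrow> (nat \<Rightarrow> real) \<Rightarrow> (nat \<Rightarrow> real) \<Rightarrow>
    ((nat \<Rightarrow> nat) \<Rightarrow> nat \<Rightarrow> real) \<Rightarrow> ennreal" where
  "risk M Y w \<theta> \<delta> = (\<integral>\<^sup>+ x. loss w \<theta> (\<delta> (\<lambda>i. Y i x)) \<partial>M)"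

end

theory Submission
  imports Defs
begin

text \<open>
  Write $c = w_0 - 1$ and $\varphi(v) = c/(c+v)$, so that $\widehat\theta_i = (1 - \varphi(v(Y)))\,Y_i$.
  The engine is the Poisson analogue of Stein's identity, which holds coordinatewise under
  independence: $\mathrm{E}\,Y_i F(Y) = \theta_i\,\mathrm{E}\,F(Y + e_i)$
  (\<open>poisson_model_size_bias\<close>). It removes the unknown $\theta_i$ from the cross term and the
  quadratic term of the expanded loss. Since adding $e_i$ to $Y$ turns $v(Y)$ into $v(Y) + w_i$,
  the difference of the two risks, weighted by $w_i$ and summed, is the expectation of
  \[ \sum_i w_i \bigl\{ 2\varphi(v) Y_i + (Y_i + 1)(\varphi_i^2 - 2\varphi_i) \bigr\},
     \qquad \varphi_i = \varphi(v + w_i). \]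
  Because $w_i \le 1$ and $t \mapsto t^2 - 2t$ decreases on $[0,1]$, each $\varphi_i$ may be replaced
  by $q = \varphi(v + 1)$. Then $\sum_i w_i (Y_i + 1) = v + w_0 = v + 1 + c$ is exactly the denominator
  of $q$, everything collapses, and the sum is at most
  $c^2/(c+v+1) - 2c^2/(c+v) \le -c^2/(c+v) < 0$ (\<open>shrinkage_pointwise_gain\<close>).

  All expectations are taken in $[0,\infty]$, with the negative terms moved to the other side of each
  equation. Sums and integrals can then be interchanged freely, and finiteness enters only twice:
  for $v(Y)$, almost surely, and for the expectation $A$ that is cancelled in the last step.
\<close>

section \<open>The size-bias identity for Poisson counts\<close>

text \<open>
  The Poisson weights satisfy $(n+1)\,p(n+1) = t\,p(n)$; the term $n = 0$ of the left-hand
  series vanishes, so the identity is a shift of the summation index.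
\<close>

lemma poisson_size_bias:
  fixes f :: "nat \<Rightarrow> ennreal"
  assumes t: "0 < t"
  shows "(\<integral>\<^sup>+n. of_nat n * f n \<partial>measure_pmf (poisson_pmf t))
    = ennreal t * (\<integral>\<^sup>+n. f (Suc n) \<partial>measure_pmf (poisson_pmf t))"
proof -
  let ?p = "\<lambda>n. ennreal (pmf (poisson_pmf t) n)"
  have shift: "?p (Suc n) * of_nat (Suc n) = ennreal t * ?p n" for n
  proof -
    have "pmf (poisson_pmf t) (Suc n) * real (Suc n) = t * pmf (poisson_pmf t) n"
      using t by (simp add: field_simps del: of_nat_Suc)
    then show ?thesis
      using t by (simp only: ennreal_of_nat_eq_real_of_nat flip: ennreal_mult'' ennreal_mult')
  qed
  have "(\<lambda>n. ?p (Suc n) * (of_nat (Suc n) * f (Suc n)))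
      sums (\<Sum>n. ?p (Suc n) * (of_nat (Suc n) * f (Suc n)))"
    by (rule summable_sums) simp
  then have "(\<lambda>n. ?p n * (of_nat n * f n)) sums (\<Sum>n. ?p (Suc n) * (of_nat (Suc n) * f (Suc n)))"
    unfolding sums_def
    by (subst filterlim_sequentially_Suc [symmetric]) (simp add: sum.lessThan_Suc_shift del: of_nat_Suc sum.lessThan_Suc)
  then have "(\<Sum>n. ?p n * (of_nat n * f n)) = (\<Sum>n. ?p (Suc n) * of_nat (Suc n) * f (Suc n))"
    by (simp add: sums_iff mult.assoc)
  also have "\<dots> = ennreal t * (\<Sum>n. ?p n * f (Suc n))"
    unfolding shift by (simp add: mult.assoc)
  finally show ?thesis
    by (simp only: nn_integral_measure_pmf nn_integral_count_space_nat)
qed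

text \<open>
  By independence the law of the whole sequence is that of a pair consisting of coordinate $i$ and
  the remaining coordinates. Integrating over coordinate $i$ first, with the others held fixed,
  reduces the claim to the one-dimensional identity.
\<close>

lemma poisson_model_size_bias:
  fixes F :: "(nat \<Rightarrow> nat) \<Rightarrow> ennreal"
  assumes "poisson_model M Y \<theta>" and t: "0 < \<theta> i"
    and F: "F \<in> borel_measurable (PiM UNIV (\<lambda>_. count_space UNIV))"
  shows "(\<integral>\<^sup>+x. of_nat (Y i x) * F (\<lambda>j. Y j x) \<partial>M)
    = ennreal (\<theta> i) * (\<integral>\<^sup>+x. F ((\<lambda>j. Y j x)(i := Suc (Y i x))) \<partial>M)"
proof -
  interpret prob_space M
    using assms by (simp add: poisson_model_def)
  have ind: "indep_vars (\<lambda>_. count_space UNIV) Y UNIV"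
    and law: "distr M (count_space UNIV) (Y i) = measure_pmf (poisson_pmf (\<theta> i))"
    using assms by (auto simp: poisson_model_def)
  define N where "N = PiM (- {i}) (\<lambda>_. count_space (UNIV :: nat set))"
  define R where "R x = (\<lambda>j\<in>- {i}. Y j x)" for x
  let ?P = "measure_pmf (poisson_pmf (\<theta> i))"
  \<comment> \<open>Both halves of the sequence must have the same type for \<open>indep_var\<close>, so coordinate $i$ is
    kept as a sequence restricted to the singleton \<open>{i}\<close>.\<close>
  define S where "S = PiM {i} (\<lambda>_. count_space (UNIV :: nat set))"
  define X where "X x = (\<lambda>j\<in>{i}. Y j x)" for x
  have X_i: "X x i = Y i x" for x
    by (simp add: X_def)
  have "indep_var S X N R"
    using indep_var_restrict [OF ind, of "{i}" "- {i}"]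
    by (simp add: S_def X_def [abs_def] N_def R_def [abs_def])
  then have [measurable]: "X \<in> measurable M S" "R \<in> measurable M N"
    and joint: "distr M S X \<Otimes>\<^sub>M distr M N R = distr M (S \<Otimes>\<^sub>M N) (\<lambda>x. (X x, R x))"
    by (auto simp: indep_var_distribution_eq)
  have [measurable]: "Y i \<in> measurable M (count_space UNIV)"
    using ind by (auto simp: indep_vars_def)
  have coord [measurable]: "(\<lambda>f. f i) \<in> measurable S (count_space UNIV)"
    unfolding S_def by measurable
  interpret X: prob_space "distr M S X"
    by (rule prob_space_distr) measurable
  interpret R: prob_space "distr M N R"
    by (rule prob_space_distr) measurable
  interpret XR: pair_sigma_finite "distr M S X" "distr M N R"
    by standard
  have split: "(\<integral>\<^sup>+x. h (Y i x) (R x) \<partial>M) = (\<integral>\<^sup>+r. \<integral>\<^sup>+n. h n r \<partial>?P \<partial>distr M N R)"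
    if [measurable]: "case_prod h \<in> borel_measurable (count_space UNIV \<Otimes>\<^sub>M N)"
    for h :: "nat \<Rightarrow> (nat \<Rightarrow> nat) \<Rightarrow> ennreal"
  proof -
    let ?h = "\<lambda>z. h (fst z i) (snd z)"
    have h_meas [measurable]: "?h \<in> borel_measurable (S \<Otimes>\<^sub>M N)"
      using measurable_compose [OF _ that, of "\<lambda>z. (fst z i, snd z)" "S \<Otimes>\<^sub>M N"] by simp
    then have meas: "(\<lambda>(f, r). h (f i) r) \<in> borel_measurable (distr M S X \<Otimes>\<^sub>M distr M N R)"
      by (simp add: split_beta' cong: measurable_cong_sets sets_pair_measure_cong)
    have inner: "(\<integral>\<^sup>+f. G (f i) \<partial>distr M S X) = (\<integral>\<^sup>+n. G n \<partial>?P)" for G :: "nat \<Rightarrow> ennreal"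
    proof -
      have "(\<integral>\<^sup>+f. G (f i) \<partial>distr M S X) = (\<integral>\<^sup>+x. G (Y i x) \<partial>M)"
        by (subst nn_integral_distr) (auto simp: X_i)
      also have "\<dots> = (\<integral>\<^sup>+n. G n \<partial>?P)"
        by (subst law [symmetric], subst nn_integral_distr) auto
      finally show ?thesis .
    qed
    have "(\<integral>\<^sup>+x. h (Y i x) (R x) \<partial>M) = (\<integral>\<^sup>+z. ?h z \<partial>distr M (S \<Otimes>\<^sub>M N) (\<lambda>x. (X x, R x)))"
      by (subst nn_integral_distr) (auto simp: X_i)
    also have "\<dots> = (\<integral>\<^sup>+z. ?h z \<partial>(distr M S X \<Otimes>\<^sub>M distr M N R))"
      by (simp only: joint)
    also have "\<dots> = (\<integral>\<^sup>+r. \<integral>\<^sup>+f. h (f i) r \<partial>distr M S X \<partial>distr M N R)"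
      using XR.nn_integral_snd [OF meas] by (simp add: split_beta')
    also have "\<dots> = (\<integral>\<^sup>+r. \<integral>\<^sup>+n. h n r \<partial>?P \<partial>distr M N R)"
      by (intro nn_integral_cong inner)
    finally show ?thesis .
  qed
  have upd [measurable]: "(\<lambda>z. (snd z)(i := fst z))
      \<in> measurable (count_space UNIV \<Otimes>\<^sub>M N) (PiM UNIV (\<lambda>_. count_space UNIV))"
    unfolding N_def by (rule measurable_fun_upd [where J = "- {i}"]) auto
  have upd_Suc [measurable]: "(\<lambda>z. (snd z)(i := Suc (fst z)))
      \<in> measurable (count_space UNIV \<Otimes>\<^sub>M N) (PiM UNIV (\<lambda>_. count_space UNIV))"
    unfolding N_def by (rule measurable_fun_upd [where J = "- {i}"]) (auto intro: measurable_compose [OF measurable_fst])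
  have glue: "(R x)(i := n) = (\<lambda>j. Y j x)(i := n)" for x n
    by (auto simp: R_def fun_eq_iff)
  have glue_id: "(R x)(i := Y i x) = (\<lambda>j. Y j x)" for x
    by (auto simp: glue)
  have "(\<integral>\<^sup>+x. of_nat (Y i x) * F (\<lambda>j. Y j x) \<partial>M)
      = (\<integral>\<^sup>+r. \<integral>\<^sup>+n. of_nat n * F (r(i := n)) \<partial>?P \<partial>distr M N R)"
    using split [of "\<lambda>n r. of_nat n * F (r(i := n))"] measurable_compose [OF upd F]
    by (simp add: glue_id split_beta')
  also have "\<dots> = (\<integral>\<^sup>+r. ennreal (\<theta> i) * (\<integral>\<^sup>+n. F (r(i := Suc n)) \<partial>?P) \<partial>distr M N R)"
    by (simp only: poisson_size_bias [OF t])
  also have "\<dots> = (\<integral>\<^sup>+r. \<integral>\<^sup>+n. ennreal (\<theta> i) * F (r(i := Suc n)) \<partial>?P \<partial>distr M N R)"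
    by (simp add: nn_integral_cmult)
  also have "\<dots> = (\<integral>\<^sup>+x. ennreal (\<theta> i) * F ((\<lambda>j. Y j x)(i := Suc (Y i x))) \<partial>M)"
    using split [of "\<lambda>n r. ennreal (\<theta> i) * F (r(i := Suc n))"] measurable_compose [OF upd_Suc F]
    by (simp add: glue split_beta')
  also have "\<dots> = ennreal (\<theta> i) * (\<integral>\<^sup>+x. F ((\<lambda>j. Y j x)(i := Suc (Y i x))) \<partial>M)"
  proof -
    have "(\<lambda>x. F ((\<lambda>j. Y j x)(i := Suc (Y i x)))) \<in> borel_measurable M"
      using measurable_compose [OF _ measurable_compose [OF upd_Suc F], of "\<lambda>x. (Y i x, R x)" M]
      by (simp add: glue)
    then show ?thesis
      by (rule nn_integral_cmult)
  qed
  finally show ?thesis .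
qed

section \<open>Moments and risk of a single coordinate\<close>

lemma poisson_model_measurable:
  assumes "poisson_model M Y \<theta>"
  shows "(\<lambda>x j. Y j x) \<in> measurable M (PiM UNIV (\<lambda>_. count_space UNIV))"
    and "(\<lambda>x. (\<lambda>j. Y j x)(i := Suc (Y i x))) \<in> measurable M (PiM UNIV (\<lambda>_. count_space UNIV))"
proof -
  interpret prob_space M
    using assms by (simp add: poisson_model_def)
  have [measurable]: "Y j \<in> measurable M (count_space UNIV)" for j
    using assms by (auto simp: poisson_model_def indep_vars_def)
  show "(\<lambda>x j. Y j x) \<in> measurable M (PiM UNIV (\<lambda>_. count_space UNIV))"
    by (rule measurable_PiM_single') auto
  show "(\<lambda>x. (\<lambda>j. Y j x)(i := Suc (Y i x))) \<in> measurable M (PiM UNIV (\<lambda>_. count_space UNIV))"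
    by (rule measurable_PiM_single') auto
qed

lemma poisson_model_size_bias_real:
  fixes h :: "(nat \<Rightarrow> nat) \<Rightarrow> real"
  assumes model: "poisson_model M Y \<theta>" and t: "0 < \<theta> i"
    and h: "h \<in> borel_measurable (PiM UNIV (\<lambda>_. count_space UNIV))" and nonneg: "\<And>y. 0 \<le> h y"
  shows "(\<integral>\<^sup>+x. ennreal (real (Y i x) * h (\<lambda>j. Y j x) / \<theta> i) \<partial>M)
    = (\<integral>\<^sup>+x. ennreal (h ((\<lambda>j. Y j x)(i := Suc (Y i x)))) \<partial>M)"
proof -
  let ?F = "\<lambda>y. ennreal (h y / \<theta> i)"
  have F: "?F \<in> borel_measurable (PiM UNIV (\<lambda>_. count_space UNIV))"
    using h by measurable
  have "(\<integral>\<^sup>+x. ennreal (real (Y i x) * h (\<lambda>j. Y j x) / \<theta> i) \<partial>M)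
      = (\<integral>\<^sup>+x. of_nat (Y i x) * ?F (\<lambda>j. Y j x) \<partial>M)"
    using t nonneg by (simp add: ennreal_of_nat_eq_real_of_nat flip: ennreal_mult)
  also have "\<dots> = ennreal (\<theta> i) * (\<integral>\<^sup>+x. ?F ((\<lambda>j. Y j x)(i := Suc (Y i x))) \<partial>M)"
    by (rule poisson_model_size_bias [OF model t F])
  also have "\<dots> = (\<integral>\<^sup>+x. ennreal (\<theta> i) * ?F ((\<lambda>j. Y j x)(i := Suc (Y i x))) \<partial>M)"
    by (rule nn_integral_cmult [symmetric]) (rule measurable_compose [OF poisson_model_measurable(2) [OF model] F])
  also have "\<dots> = (\<integral>\<^sup>+x. ennreal (h ((\<lambda>j. Y j x)(i := Suc (Y i x)))) \<partial>M)"
    using t nonneg by (simp flip: ennreal_mult)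
  finally show ?thesis .
qed

lemma poisson_model_mean:
  assumes "poisson_model M Y \<theta>" and "0 < \<theta> i"
  shows "(\<integral>\<^sup>+x. ennreal (real (Y i x)) \<partial>M) = ennreal (\<theta> i)"
proof -
  interpret prob_space M
    using assms by (simp add: poisson_model_def)
  show ?thesis
    using poisson_model_size_bias [OF assms, of "\<lambda>_. 1"]
    by (simp add: emeasure_space_1 ennreal_of_nat_eq_real_of_nat)
qed

text \<open>
  The size-bias identity gives $\mathrm{E}\,Y_i^2/\theta_i = \mathrm{E}\,Y_i + 1 = \theta_i + 1$. The term
  $2Y_i$ is added to the integrand to clear the negative cross term of the square.
\<close>

lemma poisson_model_normalized_variance:
  assumes model: "poisson_model M Y \<theta>" and t: "0 < \<theta> i"
  shows "(\<integral>\<^sup>+x. ennreal ((real (Y i x) - \<theta> i)\<^sup>2 / \<theta> i) \<partial>M) = 1"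
proof -
  interpret prob_space M
    using model by (simp add: poisson_model_def)
  have [measurable]: "Y i \<in> measurable M (count_space UNIV)"
    using model by (auto simp: poisson_model_def indep_vars_def)
  note mean = poisson_model_mean [OF model t]
  have expand: "ennreal ((n - \<theta> i)\<^sup>2 / \<theta> i) + ennreal 2 * ennreal n = ennreal (n * n / \<theta> i) + ennreal (\<theta> i)"
    if "0 \<le> n" for n
  proof -
    have "(n - \<theta> i)\<^sup>2 / \<theta> i + 2 * n = n * n / \<theta> i + \<theta> i"
      using t by (simp add: field_simps power2_eq_square)
    moreover have "0 \<le> (n - \<theta> i)\<^sup>2 / \<theta> i" "0 \<le> n * n / \<theta> i"
      using t that by auto
    ultimately show ?thesis
      using t that by (simp only: flip: ennreal_mult' ennreal_plus)
  qed
  have "(\<integral>\<^sup>+x. ennreal ((real (Y i x) - \<theta> i)\<^sup>2 / \<theta> i) \<partial>M) + ennreal (2 * \<theta> i)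
      = (\<integral>\<^sup>+x. ennreal ((real (Y i x) - \<theta> i)\<^sup>2 / \<theta> i) + ennreal 2 * ennreal (real (Y i x)) \<partial>M)"
    using t by (simp add: nn_integral_add nn_integral_cmult mean ennreal_mult)
  also have "\<dots> = (\<integral>\<^sup>+x. ennreal (real (Y i x) * real (Y i x) / \<theta> i) + ennreal (\<theta> i) \<partial>M)"
    by (simp only: expand of_nat_0_le_iff)
  also have "\<dots> = (\<integral>\<^sup>+x. ennreal (real (Y i x)) + 1 \<partial>M) + ennreal (\<theta> i)"
    using poisson_model_size_bias_real [OF model t, of "\<lambda>y. real (y i)"]
    by (simp add: nn_integral_add emeasure_space_1 add.commute)
  also have "\<dots> = 1 + ennreal (2 * \<theta> i)"
    using t by (simp add: nn_integral_add mean emeasure_space_1 add.assoc add.left_commute flip: ennreal_plus)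
  finally show ?thesis
    by (simp add: ennreal_add_left_cancel add.commute [of _ "ennreal (2 * \<theta> i)"])
qed

text \<open>
  The unbiased risk estimate for one coordinate of an estimator $(1 - g(Y))\,Y_i$ with an arbitrary
  shrinkage factor: expanding the square about $Y_i - \theta_i$, the terms $2 g Y_i^2/\theta_i$ and
  $g^2 Y_i^2/\theta_i$ are transformed by the size-bias identity into expressions free of $\theta$.
\<close>

lemma poisson_model_risk_identity:
  fixes g :: "(nat \<Rightarrow> nat) \<Rightarrow> real"
  assumes model: "poisson_model M Y \<theta>" and t: "0 < \<theta> i"
    and g: "g \<in> borel_measurable (PiM UNIV (\<lambda>_. count_space UNIV))" and nonneg: "\<And>y. 0 \<le> g y"
  shows "(\<integral>\<^sup>+x. ennreal (((1 - g (\<lambda>j. Y j x)) * real (Y i x) - \<theta> i)\<^sup>2 / \<theta> i) \<partial>M)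
      + (\<integral>\<^sup>+x. ennreal (2 * (real (Y i x) + 1) * g ((\<lambda>j. Y j x)(i := Suc (Y i x)))) \<partial>M)
    = 1 + (\<integral>\<^sup>+x. ennreal (2 * real (Y i x) * g (\<lambda>j. Y j x)
          + (real (Y i x) + 1) * (g ((\<lambda>j. Y j x)(i := Suc (Y i x))))\<^sup>2) \<partial>M)"
proof -
  interpret prob_space M
    using model by (simp add: poisson_model_def)
  have [measurable]: "Y i \<in> measurable M (count_space UNIV)"
    using model by (auto simp: poisson_model_def indep_vars_def)
  have [measurable]: "(\<lambda>x. g (\<lambda>j. Y j x)) \<in> borel_measurable M"
    "(\<lambda>x. g ((\<lambda>j. Y j x)(i := Suc (Y i x)))) \<in> borel_measurable M"
    by (rule measurable_compose [OF poisson_model_measurable(1) [OF model] g]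
        measurable_compose [OF poisson_model_measurable(2) [OF model] g])+
  have linear: "(\<lambda>y. 2 * real (y i) * g y) \<in> borel_measurable (PiM UNIV (\<lambda>_. count_space UNIV))"
    and quadratic: "(\<lambda>y. real (y i) * (g y)\<^sup>2) \<in> borel_measurable (PiM UNIV (\<lambda>_. count_space UNIV))"
    using g by measurable
  have cross: "(\<integral>\<^sup>+x. ennreal (real (Y i x) * (2 * real (Y i x) * g (\<lambda>j. Y j x)) / \<theta> i) \<partial>M)
      = (\<integral>\<^sup>+x. ennreal (2 * (real (Y i x) + 1) * g ((\<lambda>j. Y j x)(i := Suc (Y i x)))) \<partial>M)"
    using nonneg poisson_model_size_bias_real [OF model t linear]
    by (simp add: add.commute)
  have square: "(\<integral>\<^sup>+x. ennreal (real (Y i x) * (real (Y i x) * (g (\<lambda>j. Y j x))\<^sup>2) / \<theta> i) \<partial>M)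
      = (\<integral>\<^sup>+x. ennreal ((real (Y i x) + 1) * (g ((\<lambda>j. Y j x)(i := Suc (Y i x))))\<^sup>2) \<partial>M)"
    using nonneg poisson_model_size_bias_real [OF model t quadratic]
    by (simp add: add.commute)
  have expand: "((1 - a) * n - \<theta> i)\<^sup>2 / \<theta> i + n * (2 * n * a) / \<theta> i
      = (n - \<theta> i)\<^sup>2 / \<theta> i + (2 * n * a + n * (n * a\<^sup>2) / \<theta> i)" for a n
    using t by (simp add: field_simps power2_eq_square)
  have "(\<integral>\<^sup>+x. ennreal (((1 - g (\<lambda>j. Y j x)) * real (Y i x) - \<theta> i)\<^sup>2 / \<theta> i) \<partial>M)
      + (\<integral>\<^sup>+x. ennreal (2 * (real (Y i x) + 1) * g ((\<lambda>j. Y j x)(i := Suc (Y i x)))) \<partial>M)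
    = (\<integral>\<^sup>+x. ennreal (((1 - g (\<lambda>j. Y j x)) * real (Y i x) - \<theta> i)\<^sup>2 / \<theta> i)
        + ennreal (real (Y i x) * (2 * real (Y i x) * g (\<lambda>j. Y j x)) / \<theta> i) \<partial>M)"
    unfolding cross [symmetric] by (rule nn_integral_add [symmetric]) measurable
  also have "\<dots> = (\<integral>\<^sup>+x. ennreal ((real (Y i x) - \<theta> i)\<^sup>2 / \<theta> i)
      + (ennreal (2 * real (Y i x) * g (\<lambda>j. Y j x))
        + ennreal (real (Y i x) * (real (Y i x) * (g (\<lambda>j. Y j x))\<^sup>2) / \<theta> i)) \<partial>M)"
    using t nonneg by (simp add: expand flip: ennreal_plus)
  also have "\<dots> = 1 + ((\<integral>\<^sup>+x. ennreal (2 * real (Y i x) * g (\<lambda>j. Y j x)) \<partial>M)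
      + (\<integral>\<^sup>+x. ennreal ((real (Y i x) + 1) * (g ((\<lambda>j. Y j x)(i := Suc (Y i x))))\<^sup>2) \<partial>M))"
    by (simp only: flip: square poisson_model_normalized_variance [OF model t])
      (simp add: nn_integral_add)
  also have "\<dots> = 1 + (\<integral>\<^sup>+x. ennreal (2 * real (Y i x) * g (\<lambda>j. Y j x)
          + (real (Y i x) + 1) * (g ((\<lambda>j. Y j x)(i := Suc (Y i x))))\<^sup>2) \<partial>M)"
    using nonneg by (subst nn_integral_add [symmetric]) (auto simp flip: ennreal_plus)
  finally show ?thesis .
qed

section \<open>The shifted total of the counts\<close>

lemma poisson_model_AE_summable:
  assumes model: "poisson_model M Y \<theta>" and w: "\<And>i. 0 \<le> w i" and t: "\<And>i. 0 < \<theta> i"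
    and sum: "summable (\<lambda>i. w i * \<theta> i)"
  shows "AE x in M. summable (\<lambda>i. w i * real (Y i x))"
proof -
  interpret prob_space M
    using model by (simp add: poisson_model_def)
  have [measurable]: "Y i \<in> measurable M (count_space UNIV)" for i
    using model by (auto simp: poisson_model_def indep_vars_def)
  have "(\<integral>\<^sup>+x. (\<Sum>i. ennreal (w i * real (Y i x))) \<partial>M) = (\<Sum>i. ennreal (w i * \<theta> i))"
    using w t poisson_model_mean [OF model t]
    by (simp add: nn_integral_suminf ennreal_mult less_imp_le nn_integral_cmult)
  then have "(\<integral>\<^sup>+x. (\<Sum>i. ennreal (w i * real (Y i x))) \<partial>M) \<noteq> \<infinity>"
    using ennreal_suminf_neq_top [OF sum mult_nonneg_nonneg [OF w less_imp_le [OF t]]] by simp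
  from nn_integral_PInf_AE [OF _ this]
  have "AE x in M. (\<Sum>i. ennreal (w i * real (Y i x))) \<noteq> \<infinity>"
    by simp
  then show ?thesis
  proof eventually_elim
    case (elim x)
    then show ?case
      using w by (intro summable_suminf_not_top) simp_all
  qed
qed

lemma v_upd_Suc:
  assumes "summable (\<lambda>i. w i * real (y i))"
  shows "v w (y(i := Suc (y i))) = v w y + w i"
proof -
  have "(\<lambda>j. w j * real (y j) + (if j = i then w i else 0)) sums (v w y + w i)"
    unfolding v_def using assms by (intro sums_add summable_sums sums_single)
  moreover have "w j * real (y j) + (if j = i then w i else 0) = w j * real ((y(i := Suc (y i))) j)" for j
    by (simp add: algebra_simps)
  ultimately show ?thesis
    by (simp add: v_def sums_iff)
qed

section \<open>The pointwise gain from shrinking\<close>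

text \<open>
  Here \<open>y\<close> is a realisation of the counts and \<open>u\<close> the value of $v$. The termwise bound rests on
  \<open>(1 - p i)\<^sup>2 \<le> (1 - q)\<^sup>2\<close>. After it only the sums of \<open>w i * y i\<close> and of
  \<open>w i * (y i + 1)\<close> remain, and the latter is the denominator of \<open>q\<close>.
  The margin $c^2/(c+u)$ is not the sharpest one, but it is positive, which suffices.
\<close>

lemma shrinkage_pointwise_gain:
  fixes w y :: "nat \<Rightarrow> real"
  assumes c: "0 < c" and w: "\<And>i. 0 < w i" "\<And>i. w i \<le> 1" and y: "\<And>i. 0 \<le> y i"
    and sw: "w sums (c + 1)" and swy: "(\<lambda>i. w i * y i) sums u"
  defines "A \<equiv> \<lambda>i. 2 * w i * (y i + 1) * (c / (c + u + w i))"
    and "B \<equiv> \<lambda>i. 2 * w i * y i * (c / (c + u)) + w i * (y i + 1) * (c / (c + u + w i))\<^sup>2"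
  shows "summable A" and "summable B"
    and "suminf B + c\<^sup>2 / (c + u) \<le> suminf A"
proof -
  define p where "p i = c / (c + u + w i)" for i
  define q where "q = c / (c + u + 1)"
  have u: "0 \<le> u"
    using sums_le [OF _ sums_zero swy] y w by (simp add: less_imp_le)
  have p: "0 \<le> p i" "p i \<le> 1" "q \<le> p i" for i
    using c u w [of i] by (auto simp: p_def q_def divide_simps)
  have sw1: "(\<lambda>i. w i * (y i + 1)) sums (u + (c + 1))"
    using sums_add [OF swy sw] by (simp add: algebra_simps)
  have w1: "0 \<le> w i * (y i + 1)" for i
    using w [of i] y [of i] by simp
  have sA: "summable (\<lambda>i. w i * (y i + 1) * p i)"
    by (rule summable_comparison_test' [OF sums_summable [OF sw1], of 0])
      (simp only: real_norm_def abs_of_nonneg [OF mult_nonneg_nonneg [OF w1 p(1)]] mult_left_le [OF p(2) w1])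
  then show A: "summable A"
    unfolding A_def p_def [symmetric] using summable_mult [OF sA, of 2] by (simp add: mult.assoc)
  have sB: "summable (\<lambda>i. w i * (y i + 1) * (p i)\<^sup>2)"
    by (rule summable_comparison_test' [OF sums_summable [OF sw1], of 0])
      (simp only: real_norm_def abs_of_nonneg [OF mult_nonneg_nonneg [OF w1 zero_le_power2]]
        mult_left_le [OF power_le_one [OF p(1,2)] w1])
  have sB1: "(\<lambda>i. 2 * w i * y i * (c / (c + u))) sums (2 * u * (c / (c + u)))"
    using sums_mult [OF swy, of "2 * (c / (c + u))"] by (simp add: ac_simps)
  show B: "summable B"
    unfolding B_def p_def [symmetric] by (intro summable_add sB sums_summable [OF sB1])
  have termwise: "B i - A i \<le> 2 * w i * y i * (c / (c + u)) + (q\<^sup>2 - 2 * q) * (w i * (y i + 1))" for i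
  proof -
    have "(1 - p i)\<^sup>2 \<le> (1 - q)\<^sup>2"
      by (rule power_mono) (use p in \<open>auto\<close>)
    then have "(p i)\<^sup>2 - 2 * p i \<le> q\<^sup>2 - 2 * q"
      by (simp add: power2_eq_square algebra_simps)
    from mult_right_mono [OF this w1 [of i]] show ?thesis
      unfolding A_def B_def p_def [symmetric] by (simp add: algebra_simps)
  qed
  have "suminf B - suminf A \<le> 2 * u * (c / (c + u)) + (q\<^sup>2 - 2 * q) * (u + (c + 1))"
    by (rule sums_le [OF termwise sums_diff [OF summable_sums [OF B] summable_sums [OF A]]
          sums_add [OF sB1 sums_mult [OF sw1]]])
  also have "\<dots> = c\<^sup>2 / (c + u + 1) - 2 * c\<^sup>2 / (c + u)"
  proof -
    have "(q\<^sup>2 - 2 * q) * (u + (c + 1)) = c\<^sup>2 / (c + u + 1) - 2 * c"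
    proof -
      have "q * (u + (c + 1)) = c"
        using c u by (simp add: q_def add_ac)
      then have "(q\<^sup>2 - 2 * q) * (u + (c + 1)) = q * c - 2 * c"
        by (simp only: power2_eq_square left_diff_distrib mult.assoc)
      then show ?thesis
        by (simp add: q_def power2_eq_square)
    qed
    moreover have "2 * u * (c / (c + u)) = 2 * c - 2 * c\<^sup>2 / (c + u)"
      using c u by (simp add: field_simps power2_eq_square)
    ultimately show ?thesis by simp
  qed
  also have "c\<^sup>2 / (c + u + 1) \<le> c\<^sup>2 / (c + u)"
    using c u by (intro divide_left_mono) auto
  finally show "suminf B + c\<^sup>2 / (c + u) \<le> suminf A"
    by simp
qed


section \<open>Comparison of the risks\<close>

theorem mainTheorem6:
  fixes w \<theta> :: "nat \<Rightarrow> real"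
    and M :: "'a measure"
    and Y :: "nat \<Rightarrow> 'a \<Rightarrow> nat"
  assumes "\<And>i. 0 < w i" and "\<And>i. w i < 1"
    and "summable w" and "1 < suminf w"
    and "\<theta> \<in> Omega w"
    and "poisson_model M Y \<theta>"
  shows "risk M Y w \<theta> (theta_hat w) < risk M Y w \<theta> delta0
    \<and> risk M Y w \<theta> delta0 = ennreal (suminf w)"
proof -
  note w = assms(1) and model = assms(6)
  interpret prob_space M
    using model by (simp add: poisson_model_def)
  have [measurable]: "Y i \<in> measurable M (count_space UNIV)" for i
    using model by (auto simp: poisson_model_def indep_vars_def)
  have w0: "0 \<le> w i" for i
    using w by (simp add: less_imp_le)
  have t: "0 < \<theta> i" for i
    using assms(5) by (auto simp: Omega_def)
  have wt: "summable (\<lambda>i. w i * \<theta> i)"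
    using assms(5) by (auto simp: Omega_def)
  define c where "c = suminf w - 1"
  have c: "0 < c" and sw: "w sums (c + 1)"
    using assms(3,4) by (auto simp: c_def summable_sums)
  have weights: "(\<Sum>i. ennreal (w i)) = ennreal (suminf w)"
    using assms(3) w0 by (simp add: suminf_ennreal2)
  \<comment> \<open>The absolute value makes \<open>g\<close> nonnegative also on the null set of divergent sequences, where
    \<open>v w y\<close> could be negative; it changes nothing almost surely.\<close>
  define g where "g y = \<bar>c / (c + v w y)\<bar>" for y
  define up where "up i x = (\<lambda>j. Y j x)(i := Suc (Y i x))" for i x
  have v_meas: "v w \<in> borel_measurable (PiM UNIV (\<lambda>_. count_space UNIV))"
    unfolding v_def [abs_def] by measurable
  then have g_meas: "g \<in> borel_measurable (PiM UNIV (\<lambda>_. count_space UNIV))"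
    unfolding g_def [abs_def] by measurable
  have [measurable]: "(\<lambda>x. g (\<lambda>j. Y j x)) \<in> borel_measurable M"
    "(\<lambda>x. v w (\<lambda>j. Y j x)) \<in> borel_measurable M"
    by (rule measurable_compose [OF poisson_model_measurable(1) [OF model]] g_meas v_meas)+
  have [measurable]: "(\<lambda>x. g (up i x)) \<in> borel_measurable M" for i
    unfolding up_def by (rule measurable_compose [OF poisson_model_measurable(2) [OF model] g_meas])
  have g0: "0 \<le> g y" for y
    by (simp add: g_def)
  define L where "L i x = ennreal (((1 - g (\<lambda>j. Y j x)) * real (Y i x) - \<theta> i)\<^sup>2 / \<theta> i)" for i x
  define a where "a i x = ennreal (2 * (real (Y i x) + 1) * g (up i x))" for i x
  define b where "b i x = ennreal (2 * real (Y i x) * g (\<lambda>j. Y j x)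
    + (real (Y i x) + 1) * (g (up i x))\<^sup>2)" for i x
  have [measurable]: "L i \<in> borel_measurable M" "a i \<in> borel_measurable M" "b i \<in> borel_measurable M" for i
    unfolding L_def [abs_def] a_def [abs_def] b_def [abs_def] by measurable
  \<comment> \<open>\<open>A\<close> collects the terms that lower the risk, \<open>B\<close> those that raise it, and \<open>\<delta>\<close> is
    the pointwise margin by which the former win.\<close>
  define A where "A = (\<integral>\<^sup>+x. (\<Sum>i. ennreal (w i) * a i x) \<partial>M)"
  define B where "B = (\<integral>\<^sup>+x. (\<Sum>i. ennreal (w i) * b i x) \<partial>M)"
  define \<delta> where "\<delta> x = ennreal (c\<^sup>2 / (c + \<bar>v w (\<lambda>j. Y j x)\<bar>))" for x
  have [measurable]: "\<delta> \<in> borel_measurable M"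
    unfolding \<delta>_def [abs_def] by measurable
  have interchange: "(\<integral>\<^sup>+x. (\<Sum>i. ennreal (w i) * f i x) \<partial>M) = (\<Sum>i. ennreal (w i) * (\<integral>\<^sup>+x. f i x \<partial>M))"
    if "\<And>i. f i \<in> borel_measurable M" for f
    using that by (simp add: nn_integral_suminf nn_integral_cmult)

  have risk0: "risk M Y w \<theta> delta0 = ennreal (suminf w)"
  proof -
    have "risk M Y w \<theta> delta0
        = (\<integral>\<^sup>+x. (\<Sum>i. ennreal (w i) * ennreal ((real (Y i x) - \<theta> i)\<^sup>2 / \<theta> i)) \<partial>M)"
      using w0 t by (simp add: risk_def loss_def delta0_def less_imp_le flip: ennreal_mult')
    also have "\<dots> = (\<Sum>i. ennreal (w i))"
      using poisson_model_normalized_variance [OF model t] by (subst interchange) auto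
    finally show ?thesis
      by (simp add: weights)
  qed

  have AE_good: "AE x in M. summable (\<lambda>i. w i * real (Y i x))"
    by (rule poisson_model_AE_summable [OF model w0 t wt])
  have good: "0 \<le> v w (\<lambda>j. Y j x)" "g (\<lambda>j. Y j x) = c / (c + v w (\<lambda>j. Y j x))"
    "g (up i x) = c / (c + v w (\<lambda>j. Y j x) + w i)"
    if "summable (\<lambda>i. w i * real (Y i x))" for x i
  proof -
    show *: "0 \<le> v w (\<lambda>j. Y j x)"
      unfolding v_def using that w0 by (intro suminf_nonneg) auto
    then show "g (\<lambda>j. Y j x) = c / (c + v w (\<lambda>j. Y j x))"
      using c by (simp add: g_def)
    show "g (up i x) = c / (c + v w (\<lambda>j. Y j x) + w i)"
      using v_upd_Suc [OF that, of i] * c w0 [of i] by (simp add: g_def up_def add.assoc)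
  qed

  have risk_hat: "risk M Y w \<theta> (theta_hat w) = (\<integral>\<^sup>+x. (\<Sum>i. ennreal (w i) * L i x) \<partial>M)"
    unfolding risk_def loss_def
    by (rule nn_integral_cong_AE, use AE_good in eventually_elim)
      (use w0 in \<open>simp add: L_def good theta_hat_def flip: c_def ennreal_mult'\<close>)
  have balance: "risk M Y w \<theta> (theta_hat w) + A = ennreal (suminf w) + B"
  proof -
    have "risk M Y w \<theta> (theta_hat w) + A
        = (\<Sum>i. ennreal (w i) * ((\<integral>\<^sup>+x. L i x \<partial>M) + (\<integral>\<^sup>+x. a i x \<partial>M)))"
      by (simp add: risk_hat A_def interchange suminf_add distrib_left)
    also have "\<dots> = (\<Sum>i. ennreal (w i) * (1 + (\<integral>\<^sup>+x. b i x \<partial>M)))"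
      using poisson_model_risk_identity [OF model t g_meas g0]
      by (simp add: L_def a_def b_def up_def)
    also have "\<dots> = ennreal (suminf w) + B"
      by (simp add: B_def interchange distrib_left weights flip: suminf_add)
    finally show ?thesis .
  qed

  have "A \<le> (\<Sum>i. ennreal (w i) * ennreal (2 * (\<theta> i + 1)))"
    unfolding A_def
  proof (subst interchange, measurable, intro suminf_le mult_left_mono)
    fix i
    have "(\<integral>\<^sup>+x. a i x \<partial>M) \<le> (\<integral>\<^sup>+x. ennreal 2 * (ennreal (real (Y i x)) + 1) \<partial>M)"
    proof (rule nn_integral_mono_AE, use AE_good in eventually_elim)
      fix x assume "summable (\<lambda>i. w i * real (Y i x))"
      then have "g (up i x) \<le> 1"
        using c w0 [of i] good(1) [of x] by (simp add: good divide_simps)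
      then have "a i x \<le> ennreal (2 * (real (Y i x) + 1))"
        unfolding a_def by (intro ennreal_leI mult_left_le) auto
      then show "a i x \<le> ennreal 2 * (ennreal (real (Y i x)) + 1)"
        by (simp add: ennreal_mult)
    qed
    also have "\<dots> = ennreal (2 * (\<theta> i + 1))"
      using t [of i] poisson_model_mean [OF model t]
      by (simp add: nn_integral_cmult nn_integral_add emeasure_space_1 ennreal_mult less_imp_le)
    finally show "(\<integral>\<^sup>+x. a i x \<partial>M) \<le> ennreal (2 * (\<theta> i + 1))" .
  qed auto
  also have "\<dots> = (\<Sum>i. ennreal (2 * (w i * \<theta> i) + 2 * w i))"
    using w0 t by (simp add: algebra_simps flip: ennreal_mult')
  also have "\<dots> < top"
    using w0 t wt assms(3)
    by (subst less_top [symmetric], intro ennreal_suminf_neq_top summable_add summable_mult)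
      (simp_all add: less_imp_le)
  finally have A_fin: "A \<noteq> top"
    by simp

  have gain: "B + (\<integral>\<^sup>+x. \<delta> x \<partial>M) \<le> A"
  proof -
    have "AE x in M. (\<Sum>i. ennreal (w i) * b i x) + \<delta> x \<le> (\<Sum>i. ennreal (w i) * a i x)"
      using AE_good
    proof eventually_elim
      fix x assume S: "summable (\<lambda>i. w i * real (Y i x))"
      let ?u = "v w (\<lambda>j. Y j x)"
      let ?A = "\<lambda>i. 2 * w i * (real (Y i x) + 1) * (c / (c + ?u + w i))"
      let ?B = "\<lambda>i. 2 * w i * real (Y i x) * (c / (c + ?u))
        + w i * (real (Y i x) + 1) * (c / (c + ?u + w i))\<^sup>2"
      have "(\<lambda>i. w i * real (Y i x)) sums ?u"
        using S by (simp add: v_def summable_sums)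
      note ineq = shrinkage_pointwise_gain [OF c w less_imp_le [OF assms(2)] of_nat_0_le_iff sw this]
      have nn: "0 \<le> ?A i" "0 \<le> ?B i" for i
        using c w0 [of i] good(1) [OF S] by auto
      have "(\<Sum>i. ennreal (w i) * a i x) = (\<Sum>i. ennreal (?A i))"
        using w0 by (simp add: a_def good [OF S] ac_simps flip: ennreal_mult')
      also have "\<dots> = ennreal (suminf ?A)"
        by (rule suminf_ennreal2 [OF nn(1) ineq(1)])
      finally have sA: "(\<Sum>i. ennreal (w i) * a i x) = ennreal (suminf ?A)" .
      have "ennreal (w i) * b i x = ennreal (?B i)" for i
        unfolding b_def good(2,3) [OF S] ennreal_mult' [OF w0, symmetric]
        by (subst distrib_left) (simp only: ac_simps)
      then have "(\<Sum>i. ennreal (w i) * b i x) = (\<Sum>i. ennreal (?B i))"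
        by simp
      also have "\<dots> = ennreal (suminf ?B)"
        by (rule suminf_ennreal2 [OF nn(2) ineq(2)])
      finally have sB: "(\<Sum>i. ennreal (w i) * b i x) = ennreal (suminf ?B)" .
      have "0 \<le> suminf ?B"
        by (rule suminf_nonneg [OF ineq(2) nn(2)])
      then have "ennreal (suminf ?B) + \<delta> x = ennreal (suminf ?B + c\<^sup>2 / (c + ?u))"
        using c good(1) [OF S] by (simp add: \<delta>_def)
      then show "(\<Sum>i. ennreal (w i) * b i x) + \<delta> x \<le> (\<Sum>i. ennreal (w i) * a i x)"
        unfolding sA sB using ineq(3) by (simp add: ennreal_leI)
    qed
    from nn_integral_mono_AE [OF this] show ?thesis
      by (simp add: A_def B_def nn_integral_add)
  qed

  have \<delta>_pos: "0 < (\<integral>\<^sup>+x. \<delta> x \<partial>M)"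
  proof -
    have "0 < \<delta> x" for x
      using c by (simp add: \<delta>_def add_pos_nonneg)
    then have "\<not> (AE x in M. \<delta> x = 0)"
      by (simp add: less_le)
    then show ?thesis
      by (simp add: nn_integral_0_iff_AE zero_less_iff_neq_zero)
  qed
  have "risk M Y w \<theta> (theta_hat w) + (\<integral>\<^sup>+x. \<delta> x \<partial>M) + A
      = ennreal (suminf w) + (B + (\<integral>\<^sup>+x. \<delta> x \<partial>M))"
    using balance by (simp add: ac_simps)
  also have "\<dots> \<le> ennreal (suminf w) + A"
    using gain by (rule add_left_mono)
  finally have le: "risk M Y w \<theta> (theta_hat w) + (\<integral>\<^sup>+x. \<delta> x \<partial>M) \<le> ennreal (suminf w)"
    using A_fin by (simp add: ennreal_add_left_cancel_le add.commute [of _ A])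
  then have "risk M Y w \<theta> (theta_hat w) \<noteq> top"
    by (auto simp: top_unique)
  then have "risk M Y w \<theta> (theta_hat w) < risk M Y w \<theta> (theta_hat w) + (\<integral>\<^sup>+x. \<delta> x \<partial>M)"
    using \<delta>_pos ennreal_add_left_cancel_less [of "risk M Y w \<theta> (theta_hat w)" 0] by simp
  also have "\<dots> \<le> ennreal (suminf w)"
    by (rule le)
  finally show ?thesis
    using risk0 by simp
qed

end
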